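(* Let $\nu$ be a $\sigma$-finite measure on a compact metric space $(T,\rho)$, and let $Y=\{Y(t),t\in T\}$ be a measurable random process from the space $\mathbf F_\psi(\Omega)$, where $\mathbf F_\psi(\Omega)$ satisfies condition $\mathbf H$ with constant $C_\psi$. Let $EY(t)=m(t)$ and $$Z_n(t)=\frac1n\sum_{k=1}^nY_k(t)-m(t)=\frac1n\sum_{k=1}^n(Y_k(t)-m(t)),$$ where $Y_k(t)$ are independent copies of $Y(t)$. Then for all $p\ge1$ $$\left\|\left(\int_T|Z_n(t)|^p\,d\nu(t)\right)^{1/p}\right\|_\psi\le\frac{2\sqrt{C_\psi}}{\sqrt n}\cdot\frac{\psi(p)}{\psi(1)}\left(\int_T\|Y(t)\|_\psi^p\,d\nu(t)\right)^{1/p},$$ and for any $\varepsilon>0$ $$P\left\{\left(\int_T|Z_n(t)|^p\,d\nu(t)\right)^{1/p}>\varepsilon\right\}\le\inf_{u\ge1}\frac{\left(\frac{2\sqrt{C_\psi}}{\sqrt n}\cdot\frac{\psi(p)}{\psi(1)}\right)^u\left(\int_T\|Y(t)\|_\psi^p\,d\nu(t)\right)^{u/p}(\psi(u))^u}{\varepsilon^u}.$$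
   Context: $\psi(u)>0$, $u\ge1$, is a monotonically increasing continuous function with $\psi(u)\to\infty$ as $u\to\infty$. $\mathbf F_\psi(\Omega)$ is the Banach space of random variables with norm $\|\xi\|_\psi=\sup_{u\ge1}\frac{(E|\xi|^u)^{1/u}}{\psi(u)}<\infty$; a process belongs to it if each $Y(t)$ does. Condition $\mathbf H$ with constant $C_\psi$: for any centered independent random variables $\xi_1,\dots,\xi_n$ from the space, $\|\sum_{i=1}^n\xi_i\|_\psi^2\le C_\psi\sum_{i=1}^n\|\xi_i\|_\psi^2$. *)

theory Defs
  imports "HOL-Probability.Probability"
begin

(* Real powers on [0, \<infinity>]; only used with exponents a > 0, where \<infinity> powr a = \<infinity>. *)
definition ennpowr :: "ennreal \<Rightarrow> real \<Rightarrow> ennreal" where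
  "ennpowr x a = (if x = \<top> then \<top> else ennreal (enn2real x powr a))"

definition psi_function :: "(real \<Rightarrow> real) \<Rightarrow> bool" where
  "psi_function \<psi> \<longleftrightarrow>
     (\<forall>u\<ge>1. 0 < \<psi> u) \<and> mono_on {1..} \<psi> \<and> continuous_on {1..} \<psi> \<and> filterlim \<psi> at_top at_top"

(* The norm as a functional of the modulus |\<xi>|, allowed to take the value \<infinity> so that it also
   applies to moduli such as an L_p norm over T that is not known to be finite. *)
definition psi_norm_mod :: "'w measure \<Rightarrow> (real \<Rightarrow> real) \<Rightarrow> ('w \<Rightarrow> ennreal) \<Rightarrow> ennreal" where
  "psi_norm_mod M \<psi> X =
     (SUP u\<in>{1..}. ennpowr (\<integral>\<^sup>+\<omega>. ennpowr (X \<omega>) u \<partial>M) (1 / u) / ennreal (\<psi> u))"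

definition psi_norm :: "'w measure \<Rightarrow> (real \<Rightarrow> real) \<Rightarrow> ('w \<Rightarrow> real) \<Rightarrow> ennreal" where
  "psi_norm M \<psi> \<xi> = psi_norm_mod M \<psi> (\<lambda>\<omega>. ennreal \<bar>\<xi> \<omega>\<bar>)"

(* Random variables are not quotiented by almost sure equality. *)
definition F_space :: "'w measure \<Rightarrow> (real \<Rightarrow> real) \<Rightarrow> ('w \<Rightarrow> real) set" where
  "F_space M \<psi> = {\<xi> \<in> borel_measurable M. psi_norm M \<psi> \<xi> < \<infinity>}"

(* 0 \<le> C is explicit because ennreal would silently truncate a negative constant to 0. *)
definition condition_H :: "'w measure \<Rightarrow> (real \<Rightarrow> real) \<Rightarrow> real \<Rightarrow> bool" where
  "condition_H M \<psi> C \<longleftrightarrow> 0 \<le> C \<and>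
     (\<forall>(n::nat) \<xi>. (\<forall>i\<in>{1..n}. \<xi> i \<in> F_space M \<psi> \<and> (\<integral>\<omega>. \<xi> i \<omega> \<partial>M) = 0) \<and>
        prob_space.indep_vars M (\<lambda>_. borel) \<xi> {1..n} \<longrightarrow>
        (psi_norm M \<psi> (\<lambda>\<omega>. \<Sum>i=1..n. \<xi> i \<omega>))\<^sup>2
          \<le> ennreal C * (\<Sum>i=1..n. (psi_norm M \<psi> (\<xi> i))\<^sup>2))"

definition measurable_process :: "'t measure \<Rightarrow> 'w measure \<Rightarrow> ('t \<Rightarrow> 'w \<Rightarrow> real) \<Rightarrow> bool" where
  "measurable_process \<nu> M Y \<longleftrightarrow> (\<lambda>(t, \<omega>). Y t \<omega>) \<in> borel_measurable (\<nu> \<Otimes>\<^sub>M M)"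

(* Independence and equality in law of processes, viewed as random elements of the product space
   of all functions on T; equality in law there is equality of all finite-dimensional
   distributions. *)
definition indep_copies ::
  "'w measure \<Rightarrow> 't set \<Rightarrow> ('t \<Rightarrow> 'w \<Rightarrow> real) \<Rightarrow> ('k \<Rightarrow> 't \<Rightarrow> 'w \<Rightarrow> real) \<Rightarrow> 'k set \<Rightarrow> bool" where
  "indep_copies M T Y Yc I \<longleftrightarrow>
     prob_space.indep_vars M (\<lambda>_. PiM T (\<lambda>_. borel)) (\<lambda>k \<omega>. \<lambda>t\<in>T. Yc k t \<omega>) I \<and>
     (\<forall>k\<in>I. distr M (PiM T (\<lambda>_. borel)) (\<lambda>\<omega>. \<lambda>t\<in>T. Yc k t \<omega>)
           = distr M (PiM T (\<lambda>_. borel)) (\<lambda>\<omega>. \<lambda>t\<in>T. Y t \<omega>))"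

definition Lp_norm_T :: "'t measure \<Rightarrow> real \<Rightarrow> ('t \<Rightarrow> real) \<Rightarrow> ennreal" where
  "Lp_norm_T \<nu> p f = ennpowr (\<integral>\<^sup>+t. ennreal (\<bar>f t\<bar> powr p) \<partial>\<nu>) (1 / p)"

end

theory Submission
  imports Defs
begin

text \<open>
  The \<open>\<psi>\<close>-norm is a supremum of the moment norms \<open>(E |\<xi>|\<^sup>u)\<^bsup>1/u\<^esup> / \<psi>(u)\<close>, so the first inequality is a
  bound on each moment of the random variable \<open>\<omega> \<mapsto> (\<integral> |Z(t)|\<^sup>p d\<nu>)\<^bsup>1/p\<^esup>\<close>.

  At a fixed point \<open>t\<close> everything is scalar. The copies of \<open>Y(t)\<close> are independent with the law of
  \<open>Y(t)\<close>, and centring at most doubles a \<open>\<psi>\<close>-norm, because \<open>|E \<xi>| \<le> (E |\<xi>|\<^sup>u)\<^bsup>1/u\<^esup>\<close>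
  (\<open>psi_norm_centered_le\<close>). Condition H then bounds the square of the \<open>\<psi>\<close>-norm of the sum of the
  centred copies by \<open>4 n C\<close> times the square of the norm of \<open>Y(t)\<close>. Division by \<open>n\<close> gives the factor
  \<open>2 \<surd>C / \<surd>n\<close> (\<open>psi_norm_centered_mean_le\<close>).

  To pass from points to the integral over \<open>T\<close>, take first an exponent \<open>u \<ge> p\<close>. By Minkowski's integral
  inequality the two norms may be interchanged at the cost of an inequality: the \<open>L\<^sub>u(\<Omega>)\<close> norm
  of the \<open>L\<^sub>p(T)\<close> norm is at most the \<open>L\<^sub>p(T)\<close> norm of the \<open>L\<^sub>u(\<Omega>)\<close> norm (\<open>mixed_Lnorm_le\<close>), and the inner
  \<open>L\<^sub>u(\<Omega>)\<close> norm is at most \<open>\<psi>(u)\<close> times the pointwise \<open>\<psi>\<close>-norm. For \<open>u < p\<close> the interchange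
  fails, but the moment norms over a probability space increase with the exponent, so the bound for
  \<open>u = p\<close> applies; it contains \<open>\<psi>(p)\<close> where \<open>\<psi>(u)\<close> is wanted, and \<open>\<psi>(p) \<le> \<psi>(u) \<psi>(p) / \<psi>(1)\<close>. This is
  the origin of the factor \<open>\<psi>(p) / \<psi>(1)\<close> (\<open>psi_norm_mod_Lnorm_le\<close>).

  The tail bound is Markov's inequality for the power \<open>u\<close>, for every \<open>u \<ge> 1\<close>.
\<close>

section \<open>Powers and norms with values in \<open>[0, \<infinity>]\<close>\<close>

lemma ennpowr_ennreal: "0 \<le> x \<Longrightarrow> ennpowr (ennreal x) a = ennreal (x powr a)"
  by (simp add: ennpowr_def)

lemma ennpowr_top [simp]: "ennpowr \<top> a = \<top>"
  by (simp add: ennpowr_def)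

lemma ennpowr_0 [simp]: "ennpowr 0 a = 0"
  by (simp add: ennpowr_def)

lemma one_ennpowr [simp]: "ennpowr 1 a = 1"
  by (simp add: ennpowr_def)

lemma ennpowr_eq_0_iff [simp]: "ennpowr x a = 0 \<longleftrightarrow> x = 0"
  by (cases x) (auto simp: ennpowr_ennreal ennreal_eq_0_iff)

lemma ennpowr_exponent_one [simp]: "ennpowr x 1 = x"
  by (cases x) (auto simp: ennpowr_ennreal)

lemma ennpowr_mono: "x \<le> y \<Longrightarrow> 0 < a \<Longrightarrow> ennpowr x a \<le> ennpowr y a"
  by (cases x; cases y) (auto simp: ennpowr_ennreal top_unique intro!: ennreal_leI powr_mono2)

lemma ennpowr_mult: "ennpowr (x * y) a = ennpowr x a * ennpowr y a"
  by (cases x; cases y)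
    (auto simp: ennpowr_ennreal powr_mult ennreal_mult ennreal_mult_top ennreal_top_mult
      simp flip: ennreal_mult)

lemma ennpowr_ennpowr [simp]: "ennpowr (ennpowr x a) b = ennpowr x (a * b)"
  by (cases x) (auto simp: ennpowr_ennreal powr_powr)

lemma measurable_ennpowr [measurable]:
  assumes [measurable]: "f \<in> borel_measurable M"
  shows "(\<lambda>x. ennpowr (f x) a) \<in> borel_measurable M"
  unfolding ennpowr_def by measurable

text \<open>
  For \<open>u \<ge> 1\<close> this is the norm of \<open>L\<^sub>u(M)\<close>, extended by the value \<open>\<infinity>\<close>. It serves both for the
  moments over the probability space and for the norm over \<open>T\<close>.
\<close>
definition Lnorm :: "'a measure \<Rightarrow> real \<Rightarrow> ('a \<Rightarrow> ennreal) \<Rightarrow> ennreal" where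
  "Lnorm M u f = ennpowr (\<integral>\<^sup>+x. ennpowr (f x) u \<partial>M) (1 / u)"

section \<open>Jensen's and Minkowski's inequalities\<close>

text \<open>
  The convex function \<open>x \<mapsto> x\<^sup>r\<close> lies above its tangent at \<open>c\<close>, written without subtraction so
  that it makes sense in \<open>[0, \<infinity>]\<close>. For positive arguments it is Young's inequality for \<open>x\<^sup>r\<close>
  and \<open>c\<^sup>r\<close> with weights \<open>1/r\<close> and \<open>1 - 1/r\<close>.
\<close>
lemma ennpowr_ge_tangent:
  assumes "0 \<le> c" "1 \<le> r"
  shows "ennreal (r * c powr (r - 1)) * x \<le> ennpowr x r + ennreal ((r - 1) * c powr r)"
proof (cases x)
  case (real a)
  have "r * c powr (r - 1) * a \<le> a powr r + (r - 1) * c powr r"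
  proof (cases "a = 0 \<or> c = 0")
    case True
    then show ?thesis using assms by auto
  next
    case False
    then have "(a powr r) powr (1 / r) * (c powr r) powr (1 - 1 / r)
        \<le> (1 / r) * a powr r + (1 - 1 / r) * c powr r"
      using assms real by (intro Youngs_inequality_0) auto
    moreover have "(a powr r) powr (1 / r) = a"
      using False assms real by (simp add: powr_powr)
    moreover have "(c powr r) powr (1 - 1 / r) = c powr (r - 1)"
      using assms by (simp add: powr_powr algebra_simps)
    ultimately show ?thesis
      using assms by (simp add: field_simps)
  qed
  then show ?thesis
    using assms real by (simp add: ennpowr_ennreal flip: ennreal_mult ennreal_plus)
qed simp

text \<open>
  Integrate the tangent inequality. If the mean is finite, the tangent at the mean gives the claim;
  if it is infinite, the tangent at \<open>1\<close> forces the right-hand side to be infinite too.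
\<close>
lemma (in prob_space) jensen_ennpowr:
  assumes [measurable]: "f \<in> borel_measurable M" and r: "1 \<le> r"
  shows "ennpowr (\<integral>\<^sup>+x. f x \<partial>M) r \<le> (\<integral>\<^sup>+x. ennpowr (f x) r \<partial>M)"
proof -
  have tangent: "ennreal (r * c powr (r - 1)) * (\<integral>\<^sup>+x. f x \<partial>M)
      \<le> (\<integral>\<^sup>+x. ennpowr (f x) r \<partial>M) + ennreal ((r - 1) * c powr r)" if "0 \<le> c" for c
  proof -
    have "ennreal (r * c powr (r - 1)) * (\<integral>\<^sup>+x. f x \<partial>M)
        = (\<integral>\<^sup>+x. ennreal (r * c powr (r - 1)) * f x \<partial>M)"
      by (simp add: nn_integral_cmult)
    also have "\<dots> \<le> (\<integral>\<^sup>+x. ennpowr (f x) r + ennreal ((r - 1) * c powr r) \<partial>M)"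
      by (intro nn_integral_mono ennpowr_ge_tangent that r)
    also have "\<dots> = (\<integral>\<^sup>+x. ennpowr (f x) r \<partial>M) + ennreal ((r - 1) * c powr r)"
      by (simp add: nn_integral_add emeasure_space_1)
    finally show ?thesis .
  qed
  show ?thesis
  proof (cases "\<integral>\<^sup>+x. f x \<partial>M")
    case top
    with tangent[of 1] r show ?thesis
      by (auto simp: ennreal_mult_top top_unique ennreal_add_eq_top)
  next
    case (real c)
    show ?thesis
    proof (cases "\<integral>\<^sup>+x. ennpowr (f x) r \<partial>M")
      case real': (real d)
      have "c powr (r - 1) * c = c powr r"
        using real r by (cases "c = 0") (auto simp: powr_diff)
      then have "r * c powr r \<le> d + (r - 1) * c powr r"
        using tangent[of c] real real' r
        by (simp add: mult.assoc flip: ennreal_mult ennreal_plus)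
      then show ?thesis
        using real real' by (simp add: ennpowr_ennreal algebra_simps ennreal_leI)
    qed simp
  qed
qed

text \<open>Lyapunov's inequality: Jensen's inequality for the exponent \<open>v / u\<close> and the function \<open>f\<^sup>u\<close>.\<close>
lemma (in prob_space) Lnorm_mono_exponent:
  assumes [measurable]: "f \<in> borel_measurable M" and "0 < u" "u \<le> v"
  shows "Lnorm M u f \<le> Lnorm M v f"
proof -
  have "ennpowr (\<integral>\<^sup>+x. ennpowr (f x) u \<partial>M) (v / u) \<le> (\<integral>\<^sup>+x. ennpowr (ennpowr (f x) u) (v / u) \<partial>M)"
    using assms by (intro jensen_ennpowr) auto
  from ennpowr_mono[OF this, of "1 / v"] show ?thesis
    using assms by (simp add: Lnorm_def)
qed

lemma Lnorm_cmult:
  assumes [measurable]: "f \<in> borel_measurable M" and "0 < u"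
  shows "Lnorm M u (\<lambda>x. c * f x) = c * Lnorm M u f"
  using assms by (simp add: Lnorm_def ennpowr_mult nn_integral_cmult)

text \<open>
  Measurability is assumed for the lower function only: in the application \<open>f t\<close> is a power of the
  \<open>\<psi>\<close>-norm of \<open>Y(t)\<close>, a supremum over uncountably many exponents. The constant is therefore moved to
  the other side, where it multiplies \<open>g\<close>.
\<close>
lemma nn_integral_le_cmult:
  assumes [measurable]: "g \<in> borel_measurable M"
    and le: "\<And>x. x \<in> space M \<Longrightarrow> g x \<le> ennreal c * f x"
  shows "(\<integral>\<^sup>+x. g x \<partial>M) \<le> ennreal c * (\<integral>\<^sup>+x. f x \<partial>M)"
proof (cases "0 < c")
  case True
  have inv: "ennreal c * ennreal (1 / c) = 1"
    using True by (simp flip: ennreal_mult)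
  have "ennreal (1 / c) * g x \<le> f x" if "x \<in> space M" for x
    using mult_left_mono[OF le[OF that], of "ennreal (1 / c)"] inv
    by (simp add: mult.assoc[symmetric] mult.commute)
  then have "ennreal (1 / c) * (\<integral>\<^sup>+x. g x \<partial>M) \<le> (\<integral>\<^sup>+x. f x \<partial>M)"
    by (simp add: nn_integral_mono flip: nn_integral_cmult)
  from mult_left_mono[OF this, of "ennreal c"] inv show ?thesis
    by (simp add: mult.assoc[symmetric])
next
  case False
  then have "(\<integral>\<^sup>+x. g x \<partial>M) \<le> (\<integral>\<^sup>+x. 0 \<partial>M)"
    using le by (intro nn_integral_mono) (auto simp: ennreal_neg)
  then show ?thesis by simp
qed

text \<open>
  Minkowski's integral inequality. Let \<open>a(x)\<close> be the \<open>L\<^sub>r\<close> norm of \<open>h(x, \<cdot>)\<close> and \<open>A\<close> its integral. If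
  \<open>0 < A < \<infinity>\<close>, then \<open>(a / A) dM1\<close> is a probability measure, and the inner integral of \<open>h\<close> is
  \<open>A\<close> times the mean of \<open>h / a\<close> under it. Jensen's inequality bounds the \<open>r\<close>-th power of
  this mean by the mean of \<open>(h / a)\<^sup>r\<close>, and each \<open>h(x, \<cdot>) / a(x)\<close> has \<open>L\<^sub>r\<close> norm at most \<open>1\<close>. In contrast
  to the proof by Hoelder's inequality, there is no division by a power of the left-hand side, which
  might be infinite.
\<close>
lemma (in pair_sigma_finite) minkowski_nn_integral:
  assumes h [measurable]: "(\<lambda>(x, y). h x y) \<in> borel_measurable (M1 \<Otimes>\<^sub>M M2)" and r: "1 \<le> r"
  shows "Lnorm M2 r (\<lambda>y. \<integral>\<^sup>+x. h x y \<partial>M1) \<le> (\<integral>\<^sup>+x. Lnorm M2 r (h x) \<partial>M1)"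
proof -
  define a where "a x = Lnorm M2 r (h x)" for x
  define A where "A = (\<integral>\<^sup>+x. a x \<partial>M1)"
  have a [measurable]: "a \<in> borel_measurable M1"
    unfolding a_def Lnorm_def by measurable
  have moment: "(\<integral>\<^sup>+y. ennpowr (h x y) r \<partial>M2) = ennpowr (a x) r" for x
    using r by (simp add: a_def Lnorm_def)
  have "Lnorm M2 r (\<lambda>y. \<integral>\<^sup>+x. h x y \<partial>M1) \<le> A"
  proof (cases "A = \<top>")
    case False
    (* Normalisation by a loses nothing almost everywhere: where a x = 0 the function h x vanishes
       almost everywhere, and a is almost everywhere finite. *)
    have "AE x in M1. a x \<noteq> \<top>"
      using False nn_integral_noteq_infinite[of a M1] by (simp add: A_def)
    then have "AE x in M1. AE y in M2. h x y = h x y / a x * a x"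
      using AE_space
    proof (eventually_elim)
      case (elim x)
      show ?case
      proof (cases "a x = 0")
        case True
        then have "(\<integral>\<^sup>+y. ennpowr (h x y) r \<partial>M2) = 0"
          by (simp add: moment)
        then have "AE y in M2. ennpowr (h x y) r = 0"
          using elim by (subst (asm) nn_integral_0_iff_AE) auto
        then show ?thesis
          by (simp add: True)
      next
        case False
        with elim show ?thesis
          by (simp add: ennreal_divide_times ennreal_divide_self less_top)
      qed
    qed
    then have AE: "AE y in M2. AE x in M1. h x y = h x y / a x * a x"
      by (subst (asm) AE_commute) measurable
    show ?thesis
    proof (cases "A = 0")
      case True
      then have zero: "AE x in M1. a x = 0"
        unfolding A_def by (subst (asm) nn_integral_0_iff_AE) auto
      from AE have "AE y in M2. (\<integral>\<^sup>+x. h x y \<partial>M1) = (\<integral>\<^sup>+x. 0 \<partial>M1)"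
      proof eventually_elim
        case (elim y)
        from elim zero have "AE x in M1. h x y = 0"
          by eventually_elim simp
        then show ?case by (rule nn_integral_cong_AE)
      qed
      then have "(\<integral>\<^sup>+y. ennpowr (\<integral>\<^sup>+x. h x y \<partial>M1) r \<partial>M2) = (\<integral>\<^sup>+y. 0 \<partial>M2)"
        by (intro nn_integral_cong_AE) auto
      then show ?thesis
        by (simp add: Lnorm_def)
    next
      case A0: False
      have A_cancel: "A * (b / A) = b" for b
        using A0 False by (simp add: ennreal_times_divide mult_divide_eq_ennreal mult.commute[of A])
      have A_self: "A / A = 1"
        using A0 False by (intro ennreal_divide_self) (simp_all add: less_top)
      define N where "N = density M1 (\<lambda>x. a x / A)"
      interpret N: prob_space N
      proof
        show "emeasure N (space N) = 1"
          by (simp add: N_def emeasure_density nn_integral_divide A_self flip: A_def)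
      qed
      have "(\<integral>\<^sup>+y. ennpowr (\<integral>\<^sup>+x. h x y \<partial>M1) r \<partial>M2)
          \<le> (\<integral>\<^sup>+y. ennpowr A r * (\<integral>\<^sup>+x. a x / A * ennpowr (h x y / a x) r \<partial>M1) \<partial>M2)"
      proof (intro nn_integral_mono_AE)
        show "AE y in M2. ennpowr (\<integral>\<^sup>+x. h x y \<partial>M1) r
            \<le> ennpowr A r * (\<integral>\<^sup>+x. a x / A * ennpowr (h x y / a x) r \<partial>M1)"
          using AE AE_space
        proof (eventually_elim)
          case (elim y)
          (* The factor A / A is inserted to expose the density a / A of N. *)
          have "(\<integral>\<^sup>+x. h x y \<partial>M1) = (\<integral>\<^sup>+x. A * (a x / A * (h x y / a x)) \<partial>M1)"
            using elim by (intro nn_integral_cong_AE)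
              (auto simp: A_cancel mult.assoc[symmetric] mult.commute)
          also have "\<dots> = A * (\<integral>\<^sup>+x. h x y / a x \<partial>N)"
            using elim by (simp add: N_def nn_integral_density nn_integral_cmult)
          finally have "ennpowr (\<integral>\<^sup>+x. h x y \<partial>M1) r = ennpowr A r * ennpowr (\<integral>\<^sup>+x. h x y / a x \<partial>N) r"
            by (simp add: ennpowr_mult)
          also have "\<dots> \<le> ennpowr A r * (\<integral>\<^sup>+x. ennpowr (h x y / a x) r \<partial>N)"
            using elim r by (intro mult_left_mono N.jensen_ennpowr) (auto simp: N_def)
          also have "(\<integral>\<^sup>+x. ennpowr (h x y / a x) r \<partial>N) = (\<integral>\<^sup>+x. a x / A * ennpowr (h x y / a x) r \<partial>M1)"
            using elim by (simp add: N_def nn_integral_density)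
          finally show ?case .
        qed
      qed
      also have "\<dots> = ennpowr A r * (\<integral>\<^sup>+x. \<integral>\<^sup>+y. a x / A * ennpowr (h x y / a x) r \<partial>M2 \<partial>M1)"
        by (subst nn_integral_cmult, measurable, subst Fubini', measurable)
      also have "\<dots> \<le> ennpowr A r * (\<integral>\<^sup>+x. a x / A \<partial>M1)"
      proof (intro mult_left_mono nn_integral_mono)
        fix x assume x: "x \<in> space M1"
        (* Not an equality: the quotient is 0 where a x is 0 or infinite. *)
        have "a x / a x \<le> 1"
          by (cases "a x = 0 \<or> a x = \<top>") (auto simp: ennreal_divide_self less_top)
        then have "Lnorm M2 r (\<lambda>y. h x y / a x) \<le> 1"
          using x r Lnorm_cmult[of "h x" M2 r "inverse (a x)"]
          by (simp add: divide_ennreal_def mult.commute flip: a_def)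
        from ennpowr_mono[OF this, of r] have "(\<integral>\<^sup>+y. ennpowr (h x y / a x) r \<partial>M2) \<le> 1"
          using r by (simp add: Lnorm_def)
        from mult_left_mono[OF this, of "a x / A"]
        show "(\<integral>\<^sup>+y. a x / A * ennpowr (h x y / a x) r \<partial>M2) \<le> a x / A"
          using x by (simp add: nn_integral_cmult)
      qed simp
      also have "(\<integral>\<^sup>+x. a x / A \<partial>M1) = 1"
        by (simp add: nn_integral_divide A_self flip: A_def)
      finally have "(\<integral>\<^sup>+y. ennpowr (\<integral>\<^sup>+x. h x y \<partial>M1) r \<partial>M2) \<le> ennpowr A r"
        by simp
      from ennpowr_mono[OF this, of "1 / r"] show ?thesis
        using r by (simp add: Lnorm_def)
    qed
  qed simp
  then show ?thesis
    by (simp add: A_def a_def)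
qed

text \<open>Minkowski's inequality for the exponent \<open>u / p \<ge> 1\<close> and the function \<open>h\<^sup>p\<close>.\<close>
lemma (in pair_sigma_finite) mixed_Lnorm_le:
  assumes h [measurable]: "(\<lambda>(x, y). h x y) \<in> borel_measurable (M1 \<Otimes>\<^sub>M M2)" and "0 < p" "p \<le> u"
  shows "Lnorm M2 u (\<lambda>y. Lnorm M1 p (\<lambda>x. h x y)) \<le> Lnorm M1 p (\<lambda>x. Lnorm M2 u (h x))"
proof -
  have "Lnorm M2 (u / p) (\<lambda>y. \<integral>\<^sup>+x. ennpowr (h x y) p \<partial>M1)
      \<le> (\<integral>\<^sup>+x. Lnorm M2 (u / p) (\<lambda>y. ennpowr (h x y) p) \<partial>M1)"
    using assms by (intro minkowski_nn_integral) (auto simp: case_prod_beta)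
  from ennpowr_mono[OF this, of "1 / p"] show ?thesis
    using assms by (simp add: Lnorm_def)
qed

section \<open>The \<open>\<psi>\<close>-norm\<close>

lemma Lp_norm_T_eq_Lnorm: "Lp_norm_T \<nu> p f = Lnorm \<nu> p (\<lambda>t. ennreal \<bar>f t\<bar>)"
  by (simp add: Lp_norm_T_def Lnorm_def ennpowr_ennreal)

text \<open>
  This removes the supremum and the division from the definition: a bound on the \<open>\<psi>\<close>-norm is the
  same as a bound on every moment.
\<close>
lemma psi_norm_mod_le_iff:
  assumes "psi_function \<psi>"
  shows "psi_norm_mod M \<psi> X \<le> B \<longleftrightarrow> (\<forall>u\<ge>1. Lnorm M u X \<le> ennreal (\<psi> u) * B)"
proof -
  have "x / ennreal (\<psi> u) \<le> B \<longleftrightarrow> x \<le> ennreal (\<psi> u) * B" if "1 \<le> u" for u x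
  proof
    have pos: "0 < \<psi> u" using assms that by (simp add: psi_function_def)
    assume "x / ennreal (\<psi> u) \<le> B"
    from mult_left_mono[OF this, of "ennreal (\<psi> u)"] show "x \<le> ennreal (\<psi> u) * B"
      using pos by (simp add: ennreal_times_divide mult.commute mult_divide_eq_ennreal)
  qed (use assms that in \<open>auto simp: psi_function_def intro!: divide_le_posI_ennreal\<close>)
  then show ?thesis
    by (auto simp: psi_norm_mod_def Lnorm_def[symmetric] SUP_le_iff)
qed

lemma Lnorm_le_psi_norm_mod:
  assumes "psi_function \<psi>" "1 \<le> u"
  shows "Lnorm M u X \<le> ennreal (\<psi> u) * psi_norm_mod M \<psi> X"
  using psi_norm_mod_le_iff[OF assms(1), of M X "psi_norm_mod M \<psi> X"] assms(2) by simp

lemma psi_norm_scale_le: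
  assumes [measurable]: "\<xi> \<in> borel_measurable M" and \<psi>: "psi_function \<psi>"
  shows "psi_norm M \<psi> (\<lambda>\<omega>. a * \<xi> \<omega>) \<le> ennreal \<bar>a\<bar> * psi_norm M \<psi> \<xi>"
  unfolding psi_norm_def psi_norm_mod_le_iff[OF \<psi>]
proof (intro allI impI)
  fix u :: real assume u: "1 \<le> u"
  have "Lnorm M u (\<lambda>\<omega>. ennreal \<bar>a * \<xi> \<omega>\<bar>) = ennreal \<bar>a\<bar> * Lnorm M u (\<lambda>\<omega>. ennreal \<bar>\<xi> \<omega>\<bar>)"
    using u by (simp add: abs_mult ennreal_mult Lnorm_cmult)
  then show "Lnorm M u (\<lambda>\<omega>. ennreal \<bar>a * \<xi> \<omega>\<bar>)
      \<le> ennreal (\<psi> u) * (ennreal \<bar>a\<bar> * psi_norm_mod M \<psi> (\<lambda>\<omega>. ennreal \<bar>\<xi> \<omega>\<bar>))"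
    using mult_left_mono[OF Lnorm_le_psi_norm_mod[OF \<psi> u], of "ennreal \<bar>a\<bar>"]
    by (simp add: mult_ac)
qed

lemma psi_norm_eq_distr:
  assumes [measurable]: "\<xi> \<in> borel_measurable M" "\<eta> \<in> borel_measurable M"
    and d: "distr M borel \<xi> = distr M borel \<eta>"
  shows "psi_norm M \<psi> \<xi> = psi_norm M \<psi> \<eta>"
proof -
  have "(\<integral>\<^sup>+\<omega>. ennpowr (ennreal \<bar>\<xi> \<omega>\<bar>) u \<partial>M) = (\<integral>\<^sup>+\<omega>. ennpowr (ennreal \<bar>\<eta> \<omega>\<bar>) u \<partial>M)" for u
    using nn_integral_distr[of \<xi> M borel "\<lambda>x. ennpowr (ennreal \<bar>x\<bar>) u"]
      nn_integral_distr[of \<eta> M borel "\<lambda>x. ennpowr (ennreal \<bar>x\<bar>) u"] d by simp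
  then show ?thesis
    by (simp add: psi_norm_def psi_norm_mod_def)
qed

lemma F_space_integrable:
  assumes "psi_function \<psi>" "\<xi> \<in> F_space M \<psi>"
  shows "integrable M \<xi>"
proof (rule integrableI_bounded)
  show "\<xi> \<in> borel_measurable M" using assms by (simp add: F_space_def)
  have "(\<integral>\<^sup>+\<omega>. ennreal \<bar>\<xi> \<omega>\<bar> \<partial>M) \<le> ennreal (\<psi> 1) * psi_norm M \<psi> \<xi>"
    using Lnorm_le_psi_norm_mod[OF assms(1), of 1 M] by (simp add: Lnorm_def psi_norm_def)
  also have "\<dots> < \<infinity>"
    using assms by (simp add: F_space_def ennreal_mult_less_top)
  finally show "(\<integral>\<^sup>+\<omega>. ennreal (norm (\<xi> \<omega>)) \<partial>M) < \<infinity>" by simp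
qed

text \<open>
  Convexity gives \<open>|x - c|\<^sup>u \<le> 2\<^bsup>u-1\<^esup> (|x|\<^sup>u + |c|\<^sup>u)\<close>, and Jensen's inequality gives \<open>|c|\<^sup>u \<le> E |\<xi>|\<^sup>u\<close>
  for the mean \<open>c\<close>. Hence \<open>E |\<xi> - c|\<^sup>u \<le> 2\<^sup>u E |\<xi>|\<^sup>u\<close>.
\<close>
lemma (in prob_space) psi_norm_centered_le:
  assumes \<psi>: "psi_function \<psi>" and \<xi>: "\<xi> \<in> F_space M \<psi>"
  shows "psi_norm M \<psi> (\<lambda>\<omega>. \<xi> \<omega> - expectation \<xi>) \<le> 2 * psi_norm M \<psi> \<xi>"
  unfolding psi_norm_def psi_norm_mod_le_iff[OF \<psi>]
proof (intro allI impI)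
  fix u :: real assume u: "1 \<le> u"
  have int: "integrable M \<xi>" by (rule F_space_integrable[OF \<psi> \<xi>])
  then have [measurable]: "\<xi> \<in> borel_measurable M" by auto
  define c where "c = expectation \<xi>"
  define m where "m = ennpowr (ennreal \<bar>c\<bar>) u"
  let ?X = "\<lambda>\<omega>. ennreal \<bar>\<xi> \<omega>\<bar>"
  have "ennreal \<bar>c\<bar> \<le> (\<integral>\<^sup>+\<omega>. ?X \<omega> \<partial>M)"
    using integral_norm_bound_ennreal[OF int] by (simp add: c_def)
  then have "m \<le> ennpowr (\<integral>\<^sup>+\<omega>. ?X \<omega> \<partial>M) u"
    unfolding m_def using u by (intro ennpowr_mono) auto
  also have "\<dots> \<le> (\<integral>\<^sup>+\<omega>. ennpowr (?X \<omega>) u \<partial>M)"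
    using u by (intro jensen_ennpowr) auto
  finally have m: "m \<le> (\<integral>\<^sup>+\<omega>. ennpowr (?X \<omega>) u \<partial>M)" .
  have pt: "ennpowr (ennreal \<bar>x - c\<bar>) u \<le> ennreal (2 powr u / 2) * (ennpowr (ennreal \<bar>x\<bar>) u + m)" for x
  proof -
    have conv: "((a + b) / 2) powr u \<le> (a powr u + b powr u) / 2" if "0 < a" "0 < b" for a b :: real
      using convex_onD[OF powr_convex[OF u], of "1/2" a b] that by (simp add: add_divide_distrib)
    (* The case where one of the two points is the end point 0 of the half-line. *)
    have zero: "(a / 2) powr u \<le> a powr u / 2" if "0 \<le> a" for a :: real
    proof -
      have "(1 / 2) powr u \<le> (1/2 :: real) powr 1"
        using u by (intro powr_mono') auto
      then show ?thesis
        using mult_left_mono[of "(1/2) powr u" "1/2" "a powr u"] that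
        by (simp add: powr_divide field_simps)
    qed
    have "((\<bar>x\<bar> + \<bar>c\<bar>) / 2) powr u \<le> (\<bar>x\<bar> powr u + \<bar>c\<bar> powr u) / 2"
      using conv[of "\<bar>x\<bar>" "\<bar>c\<bar>"] zero[of "\<bar>x\<bar>"] zero[of "\<bar>c\<bar>"] by (cases "x = 0"; cases "c = 0") auto
    moreover have "\<bar>x - c\<bar> powr u \<le> (\<bar>x\<bar> + \<bar>c\<bar>) powr u"
      using u by (intro powr_mono2) auto
    ultimately have "\<bar>x - c\<bar> powr u \<le> 2 powr u / 2 * (\<bar>x\<bar> powr u + \<bar>c\<bar> powr u)"
      by (simp add: powr_divide field_simps)
    then show ?thesis
      by (simp add: ennpowr_ennreal m_def ennreal_leI flip: ennreal_plus ennreal_mult)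
  qed
  have "(\<integral>\<^sup>+\<omega>. ennpowr (ennreal \<bar>\<xi> \<omega> - c\<bar>) u \<partial>M)
      \<le> (\<integral>\<^sup>+\<omega>. ennreal (2 powr u / 2) * (ennpowr (?X \<omega>) u + m) \<partial>M)"
    by (intro nn_integral_mono pt)
  also have "\<dots> = ennreal (2 powr u / 2) * ((\<integral>\<^sup>+\<omega>. ennpowr (?X \<omega>) u \<partial>M) + m)"
    by (simp add: nn_integral_cmult nn_integral_add emeasure_space_1)
  also have "\<dots> \<le> ennreal (2 powr u / 2) * (2 * (\<integral>\<^sup>+\<omega>. ennpowr (?X \<omega>) u \<partial>M))"
    using m by (intro mult_left_mono) (auto simp: mult_2 intro: add_left_mono)
  also have "\<dots> = ennpowr 2 u * (\<integral>\<^sup>+\<omega>. ennpowr (?X \<omega>) u \<partial>M)"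
    using ennpowr_ennreal[of 2 u]
    by (simp add: mult.assoc[symmetric] flip: ennreal_mult ennreal_numeral)
  finally have "ennpowr (\<integral>\<^sup>+\<omega>. ennpowr (ennreal \<bar>\<xi> \<omega> - c\<bar>) u \<partial>M) (1 / u)
      \<le> ennpowr (ennpowr 2 u * (\<integral>\<^sup>+\<omega>. ennpowr (?X \<omega>) u \<partial>M)) (1 / u)"
    using u by (intro ennpowr_mono) auto
  then have "Lnorm M u (\<lambda>\<omega>. ennreal \<bar>\<xi> \<omega> - c\<bar>) \<le> 2 * Lnorm M u ?X"
    using u by (simp add: Lnorm_def ennpowr_mult)
  also have "\<dots> \<le> 2 * (ennreal (\<psi> u) * psi_norm_mod M \<psi> ?X)"
    by (intro mult_left_mono Lnorm_le_psi_norm_mod \<psi> u) auto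
  finally show "Lnorm M u (\<lambda>\<omega>. ennreal \<bar>\<xi> \<omega> - expectation \<xi>\<bar>)
      \<le> ennreal (\<psi> u) * (2 * psi_norm_mod M \<psi> ?X)"
    by (simp add: c_def mult_ac)
qed

section \<open>Averages of independent copies\<close>

text \<open>
  Condition H is applied to the centred copies \<open>D k\<close>, each of norm at most twice that of \<open>\<xi>\<close>, which
  gives \<open>2 \<surd>C \<surd>n\<close> times the norm of \<open>\<xi>\<close> for their sum; the average divides this by \<open>n\<close>.
\<close>
lemma (in prob_space) psi_norm_centered_mean_le:
  assumes \<psi>: "psi_function \<psi>" and H: "condition_H M \<psi> C" and n: "1 \<le> n"
    and \<xi>: "\<xi> \<in> F_space M \<psi>"
    and indep: "indep_vars (\<lambda>_. borel) X {1..n}"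
    and law: "\<And>k. k \<in> {1..n} \<Longrightarrow> distr M borel (X k) = distr M borel \<xi>"
  shows "psi_norm M \<psi> (\<lambda>\<omega>. (1 / real n) * (\<Sum>k=1..n. X k \<omega>) - expectation \<xi>)
      \<le> ennreal (2 * sqrt C / sqrt (real n)) * psi_norm M \<psi> \<xi>"
proof -
  define m where "m = expectation \<xi>"
  define D where "D k \<omega> = X k \<omega> - m" for k \<omega>
  have C: "0 \<le> C" using H by (simp add: condition_H_def)
  have [measurable]: "\<xi> \<in> borel_measurable M" using \<xi> by (simp add: F_space_def)
  have X [measurable]: "X k \<in> borel_measurable M" if "k \<in> {1..n}" for k
    using indep that by (simp add: indep_vars_def)
  obtain y where y: "psi_norm M \<psi> \<xi> = ennreal y" "0 \<le> y"
    using \<xi> by (cases "psi_norm M \<psi> \<xi>") (auto simp: F_space_def)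
  have D_norm: "psi_norm M \<psi> (D k) \<le> ennreal (2 * y)"
    and D_F: "D k \<in> F_space M \<psi>" and D_mean: "expectation (D k) = 0" if k: "k \<in> {1..n}" for k
  proof -
    have norm: "psi_norm M \<psi> (X k) = psi_norm M \<psi> \<xi>"
      by (intro psi_norm_eq_distr law X k) measurable
    then have XF: "X k \<in> F_space M \<psi>"
      using \<xi> X[OF k] by (simp add: F_space_def)
    have "expectation (X k) = (\<integral>x. x \<partial>distr M borel (X k))"
      using X[OF k] by (simp add: integral_distr)
    also have "\<dots> = m"
      unfolding law[OF k] m_def by (simp add: integral_distr)
    finally have mean: "expectation (X k) = m" .
    have "psi_norm M \<psi> (D k) \<le> 2 * psi_norm M \<psi> (X k)"
      using psi_norm_centered_le[OF \<psi> XF] by (simp add: D_def[abs_def] mean)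
    then show *: "psi_norm M \<psi> (D k) \<le> ennreal (2 * y)"
      using y by (simp add: norm ennreal_mult)
    show "D k \<in> F_space M \<psi>"
      using X[OF k] le_less_trans[OF *] by (simp add: F_space_def D_def[abs_def])
    show "expectation (D k) = 0"
      using F_space_integrable[OF \<psi> XF] by (simp add: D_def[abs_def] mean prob_space)
  qed
  have "indep_vars (\<lambda>_. borel) D {1..n}"
    unfolding D_def by (rule indep_vars_compose2[OF indep]) simp
  then have "(psi_norm M \<psi> (\<lambda>\<omega>. \<Sum>k=1..n. D k \<omega>))\<^sup>2 \<le> ennreal C * (\<Sum>k=1..n. (psi_norm M \<psi> (D k))\<^sup>2)"
    using H D_F D_mean unfolding condition_H_def by blast
  also have "\<dots> \<le> ennreal C * (\<Sum>k=1..n. (ennreal (2 * y))\<^sup>2)"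
    by (intro mult_left_mono sum_mono power_mono D_norm) auto
  also have "\<dots> = ennreal ((2 * sqrt C * sqrt (real n) * y)\<^sup>2)"
    using C y by (simp add: power_mult_distrib ennreal_power ennreal_of_nat_eq_real_of_nat
      mult_ac flip: ennreal_mult)
  finally have sq: "(psi_norm M \<psi> (\<lambda>\<omega>. \<Sum>k=1..n. D k \<omega>))\<^sup>2 \<le> ennreal ((2 * sqrt C * sqrt (real n) * y)\<^sup>2)" .
  have S: "psi_norm M \<psi> (\<lambda>\<omega>. \<Sum>k=1..n. D k \<omega>) \<le> ennreal (2 * sqrt C * sqrt (real n) * y)"
  proof (cases "psi_norm M \<psi> (\<lambda>\<omega>. \<Sum>k=1..n. D k \<omega>)")
    case (real s)
    then have "s\<^sup>2 \<le> (2 * sqrt C * sqrt (real n) * y)\<^sup>2"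
      using sq by (simp add: ennreal_power)
    then have "s \<le> 2 * sqrt C * sqrt (real n) * y"
      by (rule power2_le_imp_le) (use C y in auto)
    then show ?thesis using real by (simp add: ennreal_leI)
  qed (use sq in \<open>simp add: top_unique\<close>)
  have "(\<lambda>\<omega>. (1 / real n) * (\<Sum>k=1..n. X k \<omega>) - m) = (\<lambda>\<omega>. (1 / real n) * (\<Sum>k=1..n. D k \<omega>))"
    using n by (auto simp: D_def sum_subtractf field_simps)
  moreover have "(\<lambda>\<omega>. \<Sum>k=1..n. D k \<omega>) \<in> borel_measurable M"
    using D_F by (intro borel_measurable_sum) (auto simp: F_space_def)
  ultimately have "psi_norm M \<psi> (\<lambda>\<omega>. (1 / real n) * (\<Sum>k=1..n. X k \<omega>) - m)
      \<le> ennreal (1 / real n) * psi_norm M \<psi> (\<lambda>\<omega>. \<Sum>k=1..n. D k \<omega>)"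
    using psi_norm_scale_le[OF _ \<psi>, of "\<lambda>\<omega>. \<Sum>k=1..n. D k \<omega>" M "1 / real n"]
    by simp
  also have "\<dots> \<le> ennreal (1 / real n) * ennreal (2 * sqrt C * sqrt (real n) * y)"
    by (intro mult_left_mono S) auto
  also have "\<dots> = ennreal (2 * sqrt C / sqrt (real n)) * psi_norm M \<psi> \<xi>"
  proof -
    have "1 / real n * (2 * sqrt C * sqrt (real n) * y) = 2 * sqrt C / sqrt (real n) * y"
      using n real_sqrt_pow2[of "real n"] by (simp add: field_simps power2_eq_square)
    then show ?thesis
      using C y by (simp flip: ennreal_mult)
  qed
  finally show ?thesis by (simp add: m_def)
qed

section \<open>Integration over the parameter set\<close>

text \<open>
  A pointwise bound on \<open>\<psi>\<close>-norms becomes a bound on the \<open>\<psi>\<close>-norm of the \<open>L\<^sub>p(\<nu>)\<close> norm. The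
  interchange of norms needs an exponent \<open>u \<ge> p\<close>; smaller exponents are raised to \<open>p\<close>, which costs
  the factor \<open>\<psi>(p) / \<psi>(1)\<close>.
\<close>
lemma (in prob_space) psi_norm_mod_Lnorm_le:
  fixes X :: "'t \<Rightarrow> 'a \<Rightarrow> ennreal"
  assumes \<nu>: "sigma_finite_measure \<nu>" and \<psi>: "psi_function \<psi>" and p: "1 \<le> p"
    and X [measurable]: "(\<lambda>(t, \<omega>). X t \<omega>) \<in> borel_measurable (\<nu> \<Otimes>\<^sub>M M)"
    and c: "0 \<le> c"
    and le: "\<And>t. t \<in> space \<nu> \<Longrightarrow> psi_norm_mod M \<psi> (X t) \<le> ennreal c * a t"
  shows "psi_norm_mod M \<psi> (\<lambda>\<omega>. Lnorm \<nu> p (\<lambda>t. X t \<omega>))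
      \<le> ennreal (c * (\<psi> p / \<psi> 1)) * Lnorm \<nu> p a"
proof -
  interpret \<nu>: sigma_finite_measure \<nu> by (rule \<nu>)
  interpret \<nu>M: pair_sigma_finite \<nu> M ..
  have pos: "0 < \<psi> u" if "1 \<le> u" for u
    using \<psi> that by (simp add: psi_function_def)
  have mono: "\<psi> u \<le> \<psi> v" if "1 \<le> u" "u \<le> v" for u v
    using \<psi> that by (auto simp: psi_function_def mono_on_def)
  have L_meas [measurable]: "(\<lambda>\<omega>. Lnorm \<nu> p (\<lambda>t. X t \<omega>)) \<in> borel_measurable M"
    unfolding Lnorm_def by measurable
  have large: "Lnorm M u (\<lambda>\<omega>. Lnorm \<nu> p (\<lambda>t. X t \<omega>)) \<le> ennreal (\<psi> u * c) * Lnorm \<nu> p a"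
    if u: "p \<le> u" for u
  proof -
    have "Lnorm M u (\<lambda>\<omega>. Lnorm \<nu> p (\<lambda>t. X t \<omega>)) \<le> Lnorm \<nu> p (\<lambda>t. Lnorm M u (X t))"
      using p u by (intro \<nu>M.mixed_Lnorm_le) auto
    also have "\<dots> \<le> ennpowr (ennreal ((\<psi> u * c) powr p) * (\<integral>\<^sup>+t. ennpowr (a t) p \<partial>\<nu>)) (1 / p)"
      unfolding Lnorm_def[of \<nu>]
    proof (intro ennpowr_mono nn_integral_le_cmult)
      fix t assume t: "t \<in> space \<nu>"
      have "Lnorm M u (X t) \<le> ennreal (\<psi> u) * psi_norm_mod M \<psi> (X t)"
        using \<psi> p u by (intro Lnorm_le_psi_norm_mod) auto
      also have "\<dots> \<le> ennreal (\<psi> u) * (ennreal c * a t)"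
        by (intro mult_left_mono le t) auto
      also have "\<dots> = ennreal (\<psi> u * c) * a t"
        using c pos[of u] p u by (simp add: ennreal_mult mult.assoc)
      finally have "ennpowr (Lnorm M u (X t)) p \<le> ennpowr (ennreal (\<psi> u * c) * a t) p"
        using p by (intro ennpowr_mono) auto
      then show "ennpowr (Lnorm M u (X t)) p \<le> ennreal ((\<psi> u * c) powr p) * ennpowr (a t) p"
        using c pos[of u] p u by (simp add: ennpowr_mult ennpowr_ennreal)
    qed (use p in \<open>auto simp: Lnorm_def\<close>)
    also have "\<dots> = ennreal (\<psi> u * c) * Lnorm \<nu> p a"
      using c pos[of u] p u by (simp add: ennpowr_mult ennpowr_ennreal powr_powr Lnorm_def)
    finally show ?thesis .
  qed
  show ?thesis
    unfolding psi_norm_mod_le_iff[OF \<psi>]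
  proof (intro allI impI)
    fix u :: real assume u: "1 \<le> u"
    (* v is the larger of u and p. *)
    obtain v where v: "Lnorm M u (\<lambda>\<omega>. Lnorm \<nu> p (\<lambda>t. X t \<omega>)) \<le> ennreal (\<psi> v * c) * Lnorm \<nu> p a"
        "\<psi> v \<le> \<psi> u * (\<psi> p / \<psi> 1)"
    proof (cases "p \<le> u")
      case True
      have "1 \<le> \<psi> p / \<psi> 1" using pos[of 1] mono[of 1 p] p by simp
      then have "\<psi> u \<le> \<psi> u * (\<psi> p / \<psi> 1)"
        using pos[OF u] by (metis less_eq_real_def mult.right_neutral mult_left_mono)
      with large[OF True] show ?thesis by (rule that)
    next
      case False
      have "1 \<le> \<psi> u / \<psi> 1" using pos[of 1] mono[of 1 u] u by simp
      then have "\<psi> p * 1 \<le> \<psi> p * (\<psi> u / \<psi> 1)"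
        using pos[OF p] by (intro mult_left_mono) auto
      then have "\<psi> p \<le> \<psi> u * (\<psi> p / \<psi> 1)" by (simp add: mult.commute)
      moreover have "Lnorm M u (\<lambda>\<omega>. Lnorm \<nu> p (\<lambda>t. X t \<omega>)) \<le> Lnorm M p (\<lambda>\<omega>. Lnorm \<nu> p (\<lambda>t. X t \<omega>))"
        using False u by (intro Lnorm_mono_exponent) auto
      ultimately show ?thesis
        using large[of p] that[of p] by (meson order.trans order_refl)
    qed
    note v(1)
    also have "ennreal (\<psi> v * c) * Lnorm \<nu> p a \<le> ennreal (\<psi> u * (\<psi> p / \<psi> 1) * c) * Lnorm \<nu> p a"
      using v(2) c by (intro mult_right_mono ennreal_leI) auto
    also have "\<psi> u * (\<psi> p / \<psi> 1) * c = \<psi> u * (c * (\<psi> p / \<psi> 1))"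
      by simp
    also have "ennreal \<dots> * Lnorm \<nu> p a = ennreal (\<psi> u) * (ennreal (c * (\<psi> p / \<psi> 1)) * Lnorm \<nu> p a)"
      using pos[OF u] by (simp only: ennreal_mult' less_imp_le mult.assoc)
    finally show "Lnorm M u (\<lambda>\<omega>. Lnorm \<nu> p (\<lambda>t. X t \<omega>))
        \<le> ennreal (\<psi> u) * (ennreal (c * (\<psi> p / \<psi> 1)) * Lnorm \<nu> p a)" .
  qed
qed

text \<open>
  Markov's inequality for \<open>X\<^sup>u\<close>, whose mean is at most \<open>(\<psi>(u) B)\<^sup>u\<close> by the bound on the \<open>\<psi>\<close>-norm.
\<close>
lemma markov_psi_norm_mod:
  assumes \<psi>: "psi_function \<psi>" and [measurable]: "X \<in> borel_measurable M"
    and B: "psi_norm_mod M \<psi> X \<le> B" and "1 \<le> u" "0 < \<epsilon>"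
  shows "emeasure M {\<omega> \<in> space M. X \<omega> > ennreal \<epsilon>}
      \<le> ennpowr B u * ennreal (\<psi> u powr u) / ennreal (\<epsilon> powr u)"
proof -
  have pos: "0 < \<psi> u" using \<psi> \<open>1 \<le> u\<close> by (simp add: psi_function_def)
  have "Lnorm M u X \<le> ennreal (\<psi> u) * B"
    using B \<psi> \<open>1 \<le> u\<close> by (simp add: psi_norm_mod_le_iff)
  from ennpowr_mono[OF this, of u]
  have moment: "(\<integral>\<^sup>+\<omega>. ennpowr (X \<omega>) u \<partial>M) \<le> ennpowr B u * ennreal (\<psi> u powr u)"
    using \<open>1 \<le> u\<close> pos by (simp add: Lnorm_def ennpowr_mult ennpowr_ennreal mult.commute)
  have "{\<omega> \<in> space M. X \<omega> > ennreal \<epsilon>}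
      \<subseteq> {\<omega> \<in> space M. 1 \<le> ennreal (1 / \<epsilon> powr u) * ennpowr (X \<omega>) u}"
  proof safe
    fix \<omega> assume "ennreal \<epsilon> < X \<omega>"
    then have "ennpowr (ennreal \<epsilon>) u \<le> ennpowr (X \<omega>) u"
      using \<open>1 \<le> u\<close> by (intro ennpowr_mono) auto
    from mult_left_mono[OF this, of "ennreal (1 / \<epsilon> powr u)"]
    show "1 \<le> ennreal (1 / \<epsilon> powr u) * ennpowr (X \<omega>) u"
      using \<open>0 < \<epsilon>\<close> by (simp add: ennpowr_ennreal flip: ennreal_mult)
  qed
  then have "emeasure M {\<omega> \<in> space M. X \<omega> > ennreal \<epsilon>}
      \<le> emeasure M {\<omega> \<in> space M. 1 \<le> ennreal (1 / \<epsilon> powr u) * ennpowr (X \<omega>) u}"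
    by (intro emeasure_mono) auto
  also have "\<dots> \<le> ennreal (1 / \<epsilon> powr u) * (\<integral>\<^sup>+\<omega>. ennpowr (X \<omega>) u * indicator (space M) \<omega> \<partial>M)"
    by (intro nn_integral_Markov_inequality) auto
  also have "\<dots> = (\<integral>\<^sup>+\<omega>. ennpowr (X \<omega>) u \<partial>M) / ennreal (\<epsilon> powr u)"
    using \<open>0 < \<epsilon>\<close> by (simp add: divide_ennreal_def inverse_ennreal inverse_eq_divide mult.commute
      cong: nn_integral_cong_simp)
  also have "\<dots> \<le> ennpowr B u * ennreal (\<psi> u powr u) / ennreal (\<epsilon> powr u)"
    by (intro divide_right_mono_ennreal moment)
  finally show ?thesis .
qed

section \<open>The averaged process in the norm of \<open>L\<^sub>p(T)\<close>\<close>

theorem theorem8p2: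
  fixes T :: "'t::metric_space set"
    and \<nu> :: "'t measure"
    and M :: "'w measure"
    and \<psi> :: "real \<Rightarrow> real"
    and C p :: real
    and Y :: "'t \<Rightarrow> 'w \<Rightarrow> real"
    and Yc :: "nat \<Rightarrow> 't \<Rightarrow> 'w \<Rightarrow> real"
    and m :: "'t \<Rightarrow> real"
    and Z :: "'t \<Rightarrow> 'w \<Rightarrow> real"
    and n :: nat
  assumes "compact T"
    and "sets \<nu> = sets (restrict_space borel T)"
    and "sigma_finite_measure \<nu>"
    and "prob_space M"
    and "psi_function \<psi>"
    and "condition_H M \<psi> C"
    and "measurable_process \<nu> M Y"
    and "\<And>t. t \<in> T \<Longrightarrow> Y t \<in> F_space M \<psi>"
    and "\<And>t. t \<in> T \<Longrightarrow> m t = (\<integral>\<omega>. Y t \<omega> \<partial>M)"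
    and "n \<ge> 1"
    and "\<And>k. k \<in> {1..n} \<Longrightarrow> measurable_process \<nu> M (Yc k)"
    and "indep_copies M T Y Yc {1..n}"
    and "\<And>t \<omega>. t \<in> T \<Longrightarrow> \<omega> \<in> space M \<Longrightarrow> Z t \<omega> = (1 / real n) * (\<Sum>k=1..n. Yc k t \<omega>) - m t"
    and "p \<ge> 1"
  shows "psi_norm_mod M \<psi> (\<lambda>\<omega>. Lp_norm_T \<nu> p (\<lambda>t. Z t \<omega>))
           \<le> ennreal (2 * sqrt C / sqrt (real n) * (\<psi> p / \<psi> 1))
               * ennpowr (\<integral>\<^sup>+t. ennpowr (psi_norm M \<psi> (Y t)) p \<partial>\<nu>) (1 / p)
       \<and> (\<forall>\<epsilon>>0. emeasure M {\<omega> \<in> space M. Lp_norm_T \<nu> p (\<lambda>t. Z t \<omega>) > ennreal \<epsilon>}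
           \<le> (INF u\<in>{1..}.
                 ennreal ((2 * sqrt C / sqrt (real n) * (\<psi> p / \<psi> 1)) powr u)
                   * ennpowr (\<integral>\<^sup>+t. ennpowr (psi_norm M \<psi> (Y t)) p \<partial>\<nu>) (u / p)
                   * ennreal (\<psi> u powr u) / ennreal (\<epsilon> powr u)))"
proof -
  interpret prob_space M by fact
  interpret \<nu>: sigma_finite_measure \<nu> by fact
  let ?L = "\<lambda>\<omega>. Lp_norm_T \<nu> p (\<lambda>t. Z t \<omega>)"
  let ?I = "\<integral>\<^sup>+t. ennpowr (psi_norm M \<psi> (Y t)) p \<partial>\<nu>"
  define K where "K = 2 * sqrt C / sqrt (real n) * (\<psi> p / \<psi> 1)"
  have C: "0 \<le> C" using \<open>condition_H M \<psi> C\<close> by (simp add: condition_H_def)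
  have "0 < \<psi> p" "0 < \<psi> 1"
    using \<open>psi_function \<psi>\<close> \<open>p \<ge> 1\<close> by (auto simp: psi_function_def)
  then have K: "0 \<le> K" using C by (simp add: K_def)
  have space_\<nu>: "space \<nu> = T"
    using sets_eq_imp_space_eq[OF assms(2)] by (simp add: space_restrict_space)
  have Y_meas [measurable]: "(\<lambda>(t, \<omega>). Y t \<omega>) \<in> borel_measurable (\<nu> \<Otimes>\<^sub>M M)"
    using assms(7) by (simp add: measurable_process_def)
  have Yc_meas [measurable]: "(\<lambda>(t, \<omega>). Yc k t \<omega>) \<in> borel_measurable (\<nu> \<Otimes>\<^sub>M M)" if "k \<in> {1..n}" for k
    using assms(11)[OF that] by (simp add: measurable_process_def)
  have Z_meas [measurable]: "(\<lambda>(t, \<omega>). Z t \<omega>) \<in> borel_measurable (\<nu> \<Otimes>\<^sub>M M)"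
  proof -
    have "(\<lambda>x. (1 / real n) * (\<Sum>k=1..n. Yc k (fst x) (snd x)) - (\<integral>\<omega>. Y (fst x) \<omega> \<partial>M))
        \<in> borel_measurable (\<nu> \<Otimes>\<^sub>M M)"
    proof (intro borel_measurable_diff borel_measurable_times borel_measurable_const borel_measurable_sum)
      show "(\<lambda>x. Yc k (fst x) (snd x)) \<in> borel_measurable (\<nu> \<Otimes>\<^sub>M M)" if "k \<in> {1..n}" for k
        using Yc_meas[OF that] by (simp add: case_prod_beta)
    qed measurable
    moreover have "(\<lambda>x. (1 / real n) * (\<Sum>k=1..n. Yc k (fst x) (snd x)) - (\<integral>\<omega>. Y (fst x) \<omega> \<partial>M))
        \<in> borel_measurable (\<nu> \<Otimes>\<^sub>M M) \<longleftrightarrow> ?thesis"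
      by (intro measurable_cong) (auto simp: space_pair_measure space_\<nu> assms(9,13))
    ultimately show ?thesis by blast
  qed
  have pointwise: "psi_norm M \<psi> (Z t) \<le> ennreal (2 * sqrt C / sqrt (real n)) * psi_norm M \<psi> (Y t)"
    if t: "t \<in> T" for t
  proof -
    have process: "indep_vars (\<lambda>_. PiM T (\<lambda>_. borel)) (\<lambda>k \<omega>. \<lambda>t\<in>T. Yc k t \<omega>) {1..n}"
      and law: "\<And>k. k \<in> {1..n} \<Longrightarrow> distr M (PiM T (\<lambda>_. borel)) (\<lambda>\<omega>. \<lambda>t\<in>T. Yc k t \<omega>)
           = distr M (PiM T (\<lambda>_. borel)) (\<lambda>\<omega>. \<lambda>t\<in>T. Y t \<omega>)"
      using assms(12) by (auto simp: indep_copies_def)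
    (* Evaluation at t is measurable on the product space, so independence and equality in law pass
       from the whole process to its value at t. *)
    have coord: "(\<lambda>f. f t) \<in> (PiM T (\<lambda>_. borel) :: ('t \<Rightarrow> real) measure) \<rightarrow>\<^sub>M borel"
      using t by (rule measurable_component_singleton)
    have "indep_vars (\<lambda>_. borel) (\<lambda>k. Yc k t) {1..n}"
      using indep_vars_compose2[OF process coord] t by simp
    moreover have "distr M borel (Yc k t) = distr M borel (Y t)" if k: "k \<in> {1..n}" for k
    proof -
      have Yc: "(\<lambda>\<omega>. \<lambda>t\<in>T. Yc k t \<omega>) \<in> M \<rightarrow>\<^sub>M PiM T (\<lambda>_. borel)"
        using process k by (simp add: indep_vars_def)
      have Y: "(\<lambda>\<omega>. \<lambda>t\<in>T. Y t \<omega>) \<in> M \<rightarrow>\<^sub>M PiM T (\<lambda>_. borel)"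
        using assms(8) by (intro measurable_restrict) (auto simp: F_space_def)
      show ?thesis
        using law[OF k] distr_distr[OF coord Yc] distr_distr[OF coord Y] t by (simp add: comp_def)
    qed
    ultimately have "psi_norm M \<psi> (\<lambda>\<omega>. (1 / real n) * (\<Sum>k=1..n. Yc k t \<omega>) - expectation (Y t))
        \<le> ennreal (2 * sqrt C / sqrt (real n)) * psi_norm M \<psi> (Y t)"
      using assms t by (intro psi_norm_centered_mean_le) auto
    moreover have "psi_norm M \<psi> (Z t)
        = psi_norm M \<psi> (\<lambda>\<omega>. (1 / real n) * (\<Sum>k=1..n. Yc k t \<omega>) - expectation (Y t))"
      using t assms(9,13) unfolding psi_norm_def psi_norm_mod_def
      by (auto intro!: SUP_cong arg_cong2[where f = "(/)"] arg_cong2[where f = ennpowr] nn_integral_cong)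
    ultimately show ?thesis by simp
  qed
  have bound: "psi_norm_mod M \<psi> ?L \<le> ennreal K * ennpowr ?I (1 / p)"
    unfolding K_def Lp_norm_T_eq_Lnorm Lnorm_def[of \<nu> p "\<lambda>t. psi_norm M \<psi> (Y t)", symmetric]
    using assms C pointwise
    by (intro psi_norm_mod_Lnorm_le) (auto simp: space_\<nu> case_prod_beta simp flip: psi_norm_def)
  have L_meas: "?L \<in> borel_measurable M"
    unfolding Lp_norm_T_def by measurable
  have "emeasure M {\<omega> \<in> space M. ?L \<omega> > ennreal \<epsilon>}
      \<le> ennreal (K powr u) * ennpowr ?I (u / p) * ennreal (\<psi> u powr u) / ennreal (\<epsilon> powr u)"
    if "0 < \<epsilon>" "1 \<le> u" for \<epsilon> u
    using markov_psi_norm_mod[OF \<open>psi_function \<psi>\<close> L_meas bound that(2,1)] K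
    by (simp add: ennpowr_mult ennpowr_ennreal)
  with bound show ?thesis
    unfolding K_def[symmetric] by (auto intro!: INF_greatest)
qed

end
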